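(* Let $\mathcal{G}_0$ be an edge-weighted graph with vertex set $\mathcal{V}$ whose completion $\overline{\mathcal{G}}_0$ is weakly connected. Using the same vertex set $\mathcal{V}$, enlarge $\mathcal{G}_0$ to an edge-weighted graph $\mathcal{G}_1$ by adding a sequence $\mathcal{E}_1$ of edges $e_n$ whose lengths $R_n$ satisfy $\lim_{n\to\infty}R_n=0$. Assume there is a positive constant $C$ such that $$d_{\mathcal{G}_1}(u,v)\le d_{\mathcal{G}_0}(u,v)\le C\,d_{\mathcal{G}_1}(u,v),\qquad u,v\in\mathcal{V}.$$ Then $\overline{\mathcal{G}}_1$ is weakly connected.
   Context: Graphs. Every graph $\mathcal{G}$ (in particular both $\mathcal{G}_0$ and $\mathcal{G}_1$) is simple with countable vertex set $\mathcal{V}$ and countable edge set $\mathcal{E}$; each vertex has at least one and at most finitely many incident edges. Each edge $[u,v]\in\mathcal{E}$ has a length $R(u,v)=R(v,u)\in(0,\infty)$. The edges of $\mathcal{G}_0$ keep their lengths in $\mathcal{G}_1$. Metric and completion. A finite path from $u$ to $v$ is a finite sequence of vertices $u=v_0,\dots,v_K=v$ with $[v_k,v_{k+1}]\in\mathcal{E}$. $d_{\mathcal{G}}(u,v)=\inf_\gamma\sum_k R(v_k,v_{k+1})$, the infimum over finite paths $\gamma$ in $\mathcal{G}$ from $u$ to $v$ ($\infty$ if there is none). As a metric space $\mathcal{G}$ is identified with its vertex set, and $\overline{\mathcal{G}}$ is the metric completion. Paths in the completion. A path in $\overline{\mathcal{G}}$ is a sequence $\{v_k\}$ of vertices with $[v_k,v_{k+1}]\in\mathcal{E}$,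 indexed by a finite set, by the positive integers (a ray), or by the integers (a double ray). It goes from $u\in\overline{\mathcal{G}}$ to $v\in\overline{\mathcal{G}}$ if it starts at $u$ (or, when infinite in that direction, converges to $u$) and ends at $v$ (or, when infinite in that direction, converges to $v$). Weakly connected. $\overline{\mathcal{G}}$ is weakly connected if for every pair of distinct points $u,v\in\overline{\mathcal{G}}$ there is a finite set $W$ of edges of $\mathcal{G}$ such that every path from $u$ to $v$ contains an edge from $W$. *)

theory Defs
  imports "HOL-Library.Extended_Nonnegative_Real" "HOL-Library.Countable_Set"
begin

text \<open>An undirected edge joining \<open>u\<close> and \<open>v\<close> is the two-element set \<open>{u, v}\<close>, so that
  the symmetry \<open>R(u,v) = R(v,u)\<close> of the lengths is built in.\<close>

record 'v wgraph =
  verts :: "'v set"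
  edges :: "'v set set"
  len :: "'v set \<Rightarrow> real"

locale edge_weighted_graph =
  fixes G :: "'v wgraph"
  assumes countable_verts: "countable (verts G)"
    and countable_edges: "countable (edges G)"
    and simple: "\<And>e. e \<in> edges G \<Longrightarrow> \<exists>u\<in>verts G. \<exists>v\<in>verts G. u \<noteq> v \<and> e = {u, v}"
    and incident_nonempty: "\<And>v. v \<in> verts G \<Longrightarrow> {e \<in> edges G. v \<in> e} \<noteq> {}"
    and incident_finite: "\<And>v. v \<in> verts G \<Longrightarrow> finite {e \<in> edges G. v \<in> e}"
    and len_pos: "\<And>e. e \<in> edges G \<Longrightarrow> 0 < len G e"

fun walk_edges :: "'v list \<Rightarrow> 'v set list" where
  "walk_edges [] = []"
| "walk_edges [x] = []"
| "walk_edges (x # y # zs) = {x, y} # walk_edges (y # zs)"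

definition finite_path :: "'v wgraph \<Rightarrow> 'v list \<Rightarrow> bool" where
  "finite_path G xs \<longleftrightarrow> xs \<noteq> [] \<and> set xs \<subseteq> verts G \<and> set (walk_edges xs) \<subseteq> edges G"

text \<open>The infimum is taken in \<open>ennreal\<close>, where the infimum of the empty set is \<open>\<infinity>\<close>.\<close>

definition gdist :: "'v wgraph \<Rightarrow> 'v \<Rightarrow> 'v \<Rightarrow> ennreal" where
  "gdist G u v = (INF xs \<in> {xs. finite_path G xs \<and> hd xs = u \<and> last xs = v}.
     ennreal (\<Sum>e\<leftarrow>walk_edges xs. len G e))"

text \<open>The graph metric may take the value \<open>\<infinity>\<close>, so the completion is built directly,
  as the set of equivalence classes of Cauchy sequences of vertices.\<close>

definition cauchy_seqs :: "'v wgraph \<Rightarrow> (nat \<Rightarrow> 'v) set" where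
  "cauchy_seqs G = {x. range x \<subseteq> verts G \<and>
     (\<forall>\<epsilon>>0. \<exists>N. \<forall>m\<ge>N. \<forall>n\<ge>N. gdist G (x m) (x n) < ennreal \<epsilon>)}"

definition cauchy_rel :: "'v wgraph \<Rightarrow> ((nat \<Rightarrow> 'v) \<times> (nat \<Rightarrow> 'v)) set" where
  "cauchy_rel G = {(x, y). x \<in> cauchy_seqs G \<and> y \<in> cauchy_seqs G \<and>
     (\<lambda>n. gdist G (x n) (y n)) \<longlonglongrightarrow> 0}"

definition completion :: "'v wgraph \<Rightarrow> (nat \<Rightarrow> 'v) set set" where
  "completion G = cauchy_seqs G // cauchy_rel G"

definition vertex_point :: "'v wgraph \<Rightarrow> 'v \<Rightarrow> (nat \<Rightarrow> 'v) set" where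
  "vertex_point G v = cauchy_rel G `` {\<lambda>_. v}"

definition completion_dist ::
    "'v wgraph \<Rightarrow> (nat \<Rightarrow> 'v) set \<Rightarrow> (nat \<Rightarrow> 'v) set \<Rightarrow> ennreal" where
  "completion_dist G P Q =
     (THE L. \<forall>x\<in>P. \<forall>y\<in>Q. (\<lambda>n. gdist G (x n) (y n)) \<longlonglongrightarrow> L)"

definition vertices_converge ::
    "'v wgraph \<Rightarrow> ('i \<Rightarrow> 'v) \<Rightarrow> (nat \<Rightarrow> 'v) set \<Rightarrow> 'i filter \<Rightarrow> bool" where
  "vertices_converge G p P F \<longleftrightarrow>
     ((\<lambda>k. completion_dist G (vertex_point G (p k)) P) \<longlongrightarrow> 0) F"

datatype 'v gpath =
    Finite_Path "'v list"
  | Ray "nat \<Rightarrow> 'v"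
  | Double_Ray "int \<Rightarrow> 'v"

fun gpath_edges :: "'v gpath \<Rightarrow> 'v set set" where
  "gpath_edges (Finite_Path xs) = set (walk_edges xs)"
| "gpath_edges (Ray p) = {{p k, p (k + 1)} | k. True}"
| "gpath_edges (Double_Ray p) = {{p k, p (k + 1)} | k. True}"

fun is_gpath :: "'v wgraph \<Rightarrow> 'v gpath \<Rightarrow> bool" where
  "is_gpath G (Finite_Path xs) \<longleftrightarrow> finite_path G xs"
| "is_gpath G (Ray p) \<longleftrightarrow> range p \<subseteq> verts G \<and> gpath_edges (Ray p) \<subseteq> edges G"
| "is_gpath G (Double_Ray p) \<longleftrightarrow> range p \<subseteq> verts G \<and> gpath_edges (Double_Ray p) \<subseteq> edges G"

text \<open>A ray may be infinite in either direction: it leads from its initial vertex to its limit,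
  or, traversed backwards, from its limit to its initial vertex.\<close>

fun goes_from_to ::
    "'v wgraph \<Rightarrow> 'v gpath \<Rightarrow> (nat \<Rightarrow> 'v) set \<Rightarrow> (nat \<Rightarrow> 'v) set \<Rightarrow> bool" where
  "goes_from_to G (Finite_Path xs) u v \<longleftrightarrow>
     vertex_point G (hd xs) = u \<and> vertex_point G (last xs) = v"
| "goes_from_to G (Ray p) u v \<longleftrightarrow>
     vertex_point G (p 0) = u \<and> vertices_converge G p v sequentially \<or>
     vertices_converge G p u sequentially \<and> vertex_point G (p 0) = v"
| "goes_from_to G (Double_Ray p) u v \<longleftrightarrow>
     vertices_converge G p u at_bot \<and> vertices_converge G p v at_top"

definition weakly_connected :: "'v wgraph \<Rightarrow> bool" where
  "weakly_connected G \<longleftrightarrow>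
     (\<forall>u\<in>completion G. \<forall>v\<in>completion G. u \<noteq> v \<longrightarrow>
        (\<exists>W. finite W \<and> W \<subseteq> edges G \<and>
           (\<forall>\<gamma>. is_gpath G \<gamma> \<and> goes_from_to G \<gamma> u v \<longrightarrow> gpath_edges \<gamma> \<inter> W \<noteq> {})))"

end

theory Submission
  imports Defs
begin

text \<open>If a finite edge set \<open>W\<close> meets every path of \<open>G\<^sub>0\<close> from \<open>u\<close> to \<open>v\<close> and \<open>\<delta>\<close> is the least length of an
  edge in \<open>W\<close>, then vertices at distance less than \<open>\<delta>\<close> lie in the same component of \<open>G\<^sub>0 - W\<close>.
  So the vertices close to \<open>u\<close> lie in a single component \<open>A\<close>, likewise for \<open>v\<close>, and the component
  of \<open>v\<close> is not \<open>A\<close>, since otherwise concatenated short paths would yield a path from \<open>u\<close> to \<open>v\<close>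
  avoiding \<open>W\<close>. The set \<open>A\<close> has distance at least \<open>\<delta> / C\<close> in \<open>G\<^sub>1\<close> from its complement, so only
  finitely many of the added edges leave \<open>A\<close>; together with \<open>W\<close> they separate \<open>u\<close> from \<open>v\<close> in \<open>G\<^sub>1\<close>.\<close>

section \<open>Walks\<close>

text \<open>\<open>tl\<close> removes the second copy of the junction vertex \<open>v\<close>, which
  would otherwise add a degenerate edge \<open>{v, v}\<close>.\<close>

lemma walk_edges_append:
  "xs \<noteq> [] \<Longrightarrow> ys \<noteq> [] \<Longrightarrow> last xs = hd ys \<Longrightarrow>
     walk_edges (xs @ tl ys) = walk_edges xs @ walk_edges ys"
  by (induction xs rule: walk_edges.induct) (auto simp: neq_Nil_conv)

lemma walk_edges_rev: "walk_edges (rev xs) = rev (walk_edges xs)"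
proof -
  have snoc: "walk_edges (zs @ [a, b]) = walk_edges (zs @ [a]) @ [{a, b}]" for zs and a b :: 'a
    by (induction zs rule: walk_edges.induct) auto
  show ?thesis
    by (induction xs rule: walk_edges.induct) (auto simp: snoc insert_commute)
qed

lemma walk_edges_suffix: "set (walk_edges zs) \<subseteq> set (walk_edges (ys @ zs))"
proof (induction ys)
  case (Cons a ys)
  then show ?case by (cases "ys @ zs") auto
qed simp

lemma walk_edges_prefix: "\<exists>es. walk_edges (ys @ zs) = walk_edges ys @ es"
  by (induction ys rule: walk_edges.induct) auto

text \<open>Membership in \<open>A\<close> has to change between two consecutive vertices. Edges are
  unordered, so the end inside \<open>A\<close> can be named first in whichever direction the change
  occurs.\<close>

lemma walk_edges_crossing:
  "xs \<noteq> [] \<Longrightarrow> (hd xs \<in> A) \<noteq> (last xs \<in> A) \<Longrightarrow>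
     \<exists>a b. {a, b} \<in> set (walk_edges xs) \<and> a \<in> A \<and> b \<notin> A"
proof (induction xs rule: walk_edges.induct)
  case (3 x y zs)
  show ?case
  proof (cases "(x \<in> A) = (y \<in> A)")
    case True
    with 3 show ?thesis by fastforce
  next
    case False
    then show ?thesis by (auto simp: insert_commute)
  qed
qed auto

text \<open>The concatenation is read off step by step: the state is the unread part of the current
  walk together with the index of that walk.\<close>

lemma concat_walks:
  fixes L :: "nat \<Rightarrow> 'a list"
  assumes len: "\<And>n. 2 \<le> length (L n)" and link: "\<And>n. last (L n) = hd (L (Suc n))"
  obtains p i where "p 0 = hd (L 0)" "\<And>k. {p k, p (Suc k)} \<in> set (walk_edges (L (i k)))"
    "\<And>k. p k \<in> set (L (i k))" "filterlim i at_top sequentially"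
proof -
  \<comment> \<open>Two remaining vertices mean one remaining edge, whose far end is the head of the
    next walk by \<open>link\<close>. Jumping to that walk completes this edge without visiting the
    junction twice.\<close>
  define st where "st = rec_nat (L 0, 0) (\<lambda>_ (xs, n).
    if length xs \<le> 2 then (L (Suc n), Suc n) else (tl xs, n))"
  define p where "p = (\<lambda>k. hd (fst (st k)))"
  define i where "i = (\<lambda>k. snd (st k))"
  have st_0: "st 0 = (L 0, 0)" by (simp add: st_def)
  have st_Suc: "st (Suc k) = (if length (fst (st k)) \<le> 2 then (L (Suc (i k)), Suc (i k))
      else (tl (fst (st k)), i k))" for k
    by (simp add: st_def i_def split: prod.split)
  \<comment> \<open>At least one edge is always unread, and the suffix property places it among the
    edges of \<open>L (i k)\<close>.\<close>
  have inv: "2 \<le> length (fst (st k)) \<and> (\<exists>ys. L (i k) = ys @ fst (st k))" for k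
  proof (induction k)
    case 0
    then show ?case by (simp add: st_0 len i_def)
  next
    case (Suc k)
    show ?case
    proof (cases "length (fst (st k)) \<le> 2")
      case True
      then show ?thesis by (auto simp: st_Suc len i_def)
    next
      case False
      from Suc obtain ys where ys: "L (i k) = ys @ fst (st k)" by blast
      obtain a xs where xs: "fst (st k) = a # xs" using False by (cases "fst (st k)") auto
      have "L (i k) = (ys @ [a]) @ xs" using ys xs by simp
      then have "\<exists>ys. L (i k) = ys @ xs" by blast
      moreover have "i (Suc k) = i k" "fst (st (Suc k)) = xs" using False xs
        by (simp_all add: i_def st_Suc)
      ultimately show ?thesis using False xs by simp
    qed
  qed
  have edge: "{p k, p (Suc k)} \<in> set (walk_edges (L (i k)))" for k
  proof -
    from inv[of k] obtain ys a b zs where ys: "L (i k) = ys @ fst (st k)"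
      and ab: "fst (st k) = a # b # zs"
      by (cases "fst (st k)"; cases "tl (fst (st k))") auto
    have "p (Suc k) = b"
    proof (cases "zs = []")
      case True
      then have "p (Suc k) = hd (L (Suc (i k)))" using ab by (simp add: p_def st_Suc)
      also have "\<dots> = b" using link[of "i k"] ys ab True by simp
      finally show ?thesis .
    next
      case False
      then show ?thesis using ab by (cases zs) (simp_all add: p_def st_Suc)
    qed
    moreover have "p k = a" by (simp add: p_def ab)
    ultimately have "{p k, p (Suc k)} \<in> set (walk_edges (fst (st k)))" by (simp add: ab)
    then show ?thesis using walk_edges_suffix ys by fastforce
  qed
  have mem: "p k \<in> set (L (i k))" for k
  proof -
    from inv[of k] have "fst (st k) \<noteq> []" by auto
    then have "p k \<in> set (fst (st k))" by (simp add: p_def)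
    then show ?thesis using inv[of k] by auto
  qed
  have "mono i"
    by (rule incseq_SucI) (simp add: i_def st_Suc)
  \<comment> \<open>The unread part shrinks as long as the index stays fixed, so the index must
    advance. Being monotone and attaining every natural number, \<open>i\<close> tends to
    infinity.\<close>
  have progress: "\<exists>j. i j = Suc (i k)" for k
  proof (induction "length (fst (st k))" arbitrary: k rule: less_induct)
    case less
    show ?case
    proof (cases "length (fst (st k)) \<le> 2")
      case True
      then have "i (Suc k) = Suc (i k)" by (simp add: i_def st_Suc)
      then show ?thesis by blast
    next
      case False
      then have "length (fst (st (Suc k))) < length (fst (st k))" "i (Suc k) = i k"
        by (auto simp: i_def st_Suc)
      with less[of "Suc k"] show ?thesis by simp
    qed
  qed
  have "\<exists>k. i k = n" for n
  proof (induction n)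
    case 0
    then show ?case by (intro exI[of _ 0]) (simp add: i_def st_0)
  next
    case (Suc n)
    then show ?case using progress by metis
  qed
  then have "filterlim i at_top sequentially"
    unfolding filterlim_at_top eventually_sequentially using \<open>mono i\<close> by (metis monoD)
  moreover have "p 0 = hd (L 0)" by (simp add: p_def st_0)
  ultimately show ?thesis using that edge mem by blast
qed

section \<open>Changes of side along infinite sequences\<close>

lemma nat_sequence_crossing:
  fixes p :: "nat \<Rightarrow> 'a"
  assumes "(p i \<in> A) \<noteq> (p j \<in> A)"
  shows "\<exists>k. (p k \<in> A) \<noteq> (p (k + 1) \<in> A)"
proof (rule ccontr)
  assume "\<not> ?thesis"
  then have "(p k \<in> A) = (p 0 \<in> A)" for k
    by (induction k) auto
  with assms show False by blast
qed

lemma int_sequence_crossing: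
  fixes p :: "int \<Rightarrow> 'a"
  assumes "(p i \<in> A) \<noteq> (p j \<in> A)"
  shows "\<exists>k. (p k \<in> A) \<noteq> (p (k + 1) \<in> A)"
proof (rule ccontr)
  assume *: "\<not> ?thesis"
  have "(p k \<in> A) = (p 0 \<in> A)" for k
  proof (induction k rule: int_induct[where k = 0])
    case (step2 k)
    then show ?case using * by (metis diff_add_cancel)
  qed (use * in auto)
  with assms show False by blast
qed

section \<open>The graph metric and its completion\<close>

lemma ennreal_tendsto_0_le:
  fixes f g :: "'a \<Rightarrow> ennreal"
  assumes "(g \<longlongrightarrow> 0) F" "\<And>x. f x \<le> g x"
  shows "(f \<longlongrightarrow> 0) F"
  by (rule tendsto_sandwich[OF _ _ tendsto_const assms(1)]) (simp_all add: assms(2))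

context edge_weighted_graph
begin

lemma edge_verts: "{a, b} \<in> edges G \<Longrightarrow> a \<in> verts G \<and> b \<in> verts G"
  using simple[of "{a, b}"] by (auto simp: doubleton_eq_iff)

lemma path_len_nonneg: "set es \<subseteq> edges G \<Longrightarrow> 0 \<le> (\<Sum>e\<leftarrow>es. len G e)"
  by (intro sum_list_nonneg) (auto dest!: len_pos simp: subset_iff intro: less_imp_le)

lemma gdist_le:
  "finite_path G xs \<Longrightarrow> hd xs = u \<Longrightarrow> last xs = v \<Longrightarrow>
     gdist G u v \<le> ennreal (\<Sum>e\<leftarrow>walk_edges xs. len G e)"
  unfolding gdist_def by (rule INF_lower) auto

lemma gdist_lessE:
  assumes "gdist G u v < c"
  obtains xs where "finite_path G xs" "hd xs = u" "last xs = v"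
    "ennreal (\<Sum>e\<leftarrow>walk_edges xs. len G e) < c"
  using assms unfolding gdist_def INF_less_iff by blast

lemma gdist_edge_le: "{a, b} \<in> edges G \<Longrightarrow> gdist G a b \<le> ennreal (len G {a, b})"
  using gdist_le[of "[a, b]" a b] edge_verts[of a b] by (simp add: finite_path_def)

lemma gdist_self: "v \<in> verts G \<Longrightarrow> gdist G v v = 0"
  using gdist_le[of "[v]" v v] by (simp add: finite_path_def)

lemma gdist_sym: "gdist G u v = gdist G v u"
proof -
  have "gdist G u v \<le> gdist G v u" for u v
    unfolding gdist_def[of G v u]
  proof (rule INF_greatest)
    fix xs assume "xs \<in> {xs. finite_path G xs \<and> hd xs = v \<and> last xs = u}"
    then show "gdist G u v \<le> ennreal (\<Sum>e\<leftarrow>walk_edges xs. len G e)"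
      using gdist_le[of "rev xs" u v]
      by (simp add: finite_path_def walk_edges_rev hd_rev last_rev rev_map[symmetric])
  qed
  then show ?thesis by (simp add: antisym)
qed

lemma gdist_triangle: "gdist G u w \<le> gdist G u v + gdist G v w"
proof (rule ennreal_le_epsilon)
  \<comment> \<open>Nearly optimal paths are chosen below \<open>a + ennreal (e / 2)\<close>. This
    bound exceeds \<open>a\<close> only for finite \<open>a\<close>, which is why \<open>fin\<close>
    matters.\<close>
  fix e :: real assume fin: "gdist G u v + gdist G v w < top" and e: "0 < e"
  have lt: "a < a + ennreal (e / 2)" if "a < top" for a
    using that e by (cases a) (auto simp flip: ennreal_plus simp: ennreal_less_iff)
  have "gdist G u v < top" "gdist G v w < top" using fin by auto
  then obtain xs ys where
    xs: "finite_path G xs" "hd xs = u" "last xs = v"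
      "ennreal (\<Sum>e\<leftarrow>walk_edges xs. len G e) < gdist G u v + ennreal (e / 2)" and
    ys: "finite_path G ys" "hd ys = v" "last ys = w"
      "ennreal (\<Sum>e\<leftarrow>walk_edges ys. len G e) < gdist G v w + ennreal (e / 2)"
    using gdist_lessE lt by metis
  have ne: "xs \<noteq> []" "ys \<noteq> []" using xs ys by (auto simp: finite_path_def)
  have we: "walk_edges (xs @ tl ys) = walk_edges xs @ walk_edges ys"
    using ne xs ys by (simp add: walk_edges_append)
  have "set (tl ys) \<subseteq> set ys" using ne by (cases ys) auto
  then have path: "finite_path G (xs @ tl ys)"
    using xs ys by (auto simp: finite_path_def we)
  have "last (xs @ tl ys) = w"
    using ne xs ys by (cases ys) (auto simp: last_append)
  then have "gdist G u w \<le> ennreal (\<Sum>e\<leftarrow>walk_edges xs @ walk_edges ys. len G e)"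
    using gdist_le[OF path] ne xs unfolding we by simp
  also have "\<dots> = ennreal (\<Sum>e\<leftarrow>walk_edges xs. len G e) + ennreal (\<Sum>e\<leftarrow>walk_edges ys. len G e)"
    using xs ys by (simp add: finite_path_def path_len_nonneg ennreal_plus)
  also have "\<dots> \<le> (gdist G u v + ennreal (e / 2)) + (gdist G v w + ennreal (e / 2))"
    using xs ys by (intro add_mono) auto
  also have "\<dots> = gdist G u v + gdist G v w + (ennreal (e / 2) + ennreal (e / 2))"
    by (simp add: ac_simps)
  also have "ennreal (e / 2) + ennreal (e / 2) = ennreal e"
    using e by (simp flip: ennreal_plus)
  finally show "gdist G u w \<le> gdist G u v + gdist G v w + ennreal e" .
qed

text \<open>The initial piece of the path ending at \<open>a\<close> is itself a path, and
  discarding the remaining edges cannot increase the length. This keeps concatenated short paths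
  close to the Cauchy sequence they join.\<close>

lemma gdist_hd_le:
  assumes "finite_path G xs" "a \<in> set xs"
  shows "gdist G (hd xs) a \<le> ennreal (\<Sum>e\<leftarrow>walk_edges xs. len G e)"
proof -
  obtain ys zs where xs: "xs = (ys @ [a]) @ zs"
    using assms(2) by (metis split_list append.assoc append_Cons append_Nil)
  obtain es where es: "walk_edges xs = walk_edges (ys @ [a]) @ es"
    unfolding xs using walk_edges_prefix by blast
  have sub: "set (walk_edges xs) \<subseteq> edges G" using assms(1) by (simp add: finite_path_def)
  have "finite_path G (ys @ [a])" using assms(1) es by (auto simp: finite_path_def xs)
  then have "gdist G (hd xs) a \<le> ennreal (\<Sum>e\<leftarrow>walk_edges (ys @ [a]). len G e)"
    by (rule gdist_le) (auto simp: xs hd_append)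
  also have "\<dots> \<le> ennreal (\<Sum>e\<leftarrow>walk_edges xs. len G e)"
    using path_len_nonneg[of es] sub by (intro ennreal_leI) (simp add: es)
  finally show ?thesis .
qed

section \<open>Cauchy sequences and points of the completion\<close>

lemma cauchy_seqs_const: "a \<in> verts G \<Longrightarrow> (\<lambda>_. a) \<in> cauchy_seqs G"
  by (auto simp: cauchy_seqs_def gdist_self)

lemma cauchy_seqs_tail:
  assumes "x \<in> cauchy_seqs G" "0 < \<epsilon>"
  obtains N where "\<And>m n. m \<ge> N \<Longrightarrow> n \<ge> N \<Longrightarrow> gdist G (x m) (x n) < ennreal \<epsilon>"
proof -
  have "\<exists>N. \<forall>m\<ge>N. \<forall>n\<ge>N. gdist G (x m) (x n) < ennreal \<epsilon>"
    using assms by (simp add: cauchy_seqs_def)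
  then show ?thesis using that by blast
qed

lemma cauchy_seqs_verts: "x \<in> cauchy_seqs G \<Longrightarrow> x n \<in> verts G"
  by (auto simp: cauchy_seqs_def)

lemma equiv_cauchy_rel: "equiv (cauchy_seqs G) (cauchy_rel G)"
proof (rule equivI)
  show "refl_on (cauchy_seqs G) (cauchy_rel G)"
    by (auto simp: refl_on_def cauchy_rel_def gdist_self cauchy_seqs_verts)
  show "sym (cauchy_rel G)"
    by (auto simp: sym_def cauchy_rel_def gdist_sym)
  show "trans (cauchy_rel G)"
  proof (rule transI)
    fix x y z assume a: "(x, y) \<in> cauchy_rel G" "(y, z) \<in> cauchy_rel G"
    then have "(\<lambda>n. gdist G (x n) (y n)) \<longlonglongrightarrow> 0" "(\<lambda>n. gdist G (y n) (z n)) \<longlonglongrightarrow> 0"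
      by (simp_all add: cauchy_rel_def)
    from tendsto_add[OF this]
    have "(\<lambda>n. gdist G (x n) (y n) + gdist G (y n) (z n)) \<longlonglongrightarrow> 0" by simp
    then have "(\<lambda>n. gdist G (x n) (z n)) \<longlonglongrightarrow> 0"
      by (rule ennreal_tendsto_0_le) (rule gdist_triangle)
    then show "(x, z) \<in> cauchy_rel G" using a by (auto simp: cauchy_rel_def)
  qed
qed (auto simp: cauchy_rel_def)

lemma vertex_point_self: "a \<in> verts G \<Longrightarrow> (\<lambda>_. a) \<in> vertex_point G a"
  using equiv_class_self[OF equiv_cauchy_rel cauchy_seqs_const] by (simp add: vertex_point_def)

lemma vertex_point_in_completion: "a \<in> verts G \<Longrightarrow> vertex_point G a \<in> completion G"
  unfolding vertex_point_def completion_def by (rule quotientI) (rule cauchy_seqs_const)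

lemma completion_seqs: "P \<in> completion G \<Longrightarrow> x \<in> P \<Longrightarrow> x \<in> cauchy_seqs G"
  unfolding completion_def using equiv_cauchy_rel in_quotient_imp_subset by blast

lemma completion_nonempty: "P \<in> completion G \<Longrightarrow> P \<noteq> {}"
  unfolding completion_def using equiv_cauchy_rel in_quotient_imp_non_empty by blast

lemma completion_seqs_close:
  assumes "P \<in> completion G" "x \<in> P" "y \<in> P"
  shows "(\<lambda>n. gdist G (x n) (y n)) \<longlonglongrightarrow> 0"
proof -
  have "(x, y) \<in> cauchy_rel G"
    using assms equiv_cauchy_rel in_quotient_imp_in_rel
    unfolding completion_def by fastforce
  then show ?thesis by (simp add: cauchy_rel_def)
qed

text \<open>Two triangle inequalities. The bracket collects the displacements of the two ends, which
  are small or tend to zero in the applications.\<close>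

lemma gdist_quadrangle: "gdist G a b \<le> gdist G c d + (gdist G a c + gdist G b d)"
proof -
  have "gdist G a b \<le> gdist G a c + (gdist G c d + gdist G d b)"
    by (meson add_left_mono gdist_triangle order_trans)
  then show ?thesis by (simp add: ac_simps gdist_sym[of d b])
qed

text \<open>Distances may be infinite, so the argument compares upper and lower limits: moving both
  indices far out changes the distance by at most \<open>e\<close>, hence \<open>limsup f\<close> is
  at most \<open>liminf f + e\<close> for every positive \<open>e\<close>.\<close>

lemma gdist_convergent:
  assumes "x \<in> cauchy_seqs G" "y \<in> cauchy_seqs G"
  shows "\<exists>L. (\<lambda>n. gdist G (x n) (y n)) \<longlonglongrightarrow> L"
proof -
  define f where "f = (\<lambda>n. gdist G (x n) (y n))"
  have "limsup f \<le> liminf f"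
  proof (rule ennreal_le_epsilon)
    fix e :: real assume "0 < e"
    then have "0 < e / 2" by simp
    obtain N where N: "\<And>m n. m \<ge> N \<Longrightarrow> n \<ge> N \<Longrightarrow> gdist G (x m) (x n) < ennreal (e / 2)"
      using cauchy_seqs_tail[OF assms(1) \<open>0 < e / 2\<close>] by blast
    obtain M where M: "\<And>m n. m \<ge> M \<Longrightarrow> n \<ge> M \<Longrightarrow> gdist G (y m) (y n) < ennreal (e / 2)"
      using cauchy_seqs_tail[OF assms(2) \<open>0 < e / 2\<close>] by blast
    have *: "f m \<le> f n + ennreal e" if "m \<ge> max N M" "n \<ge> max N M" for m n
    proof -
      have "f m \<le> f n + (gdist G (x m) (x n) + gdist G (y m) (y n))"
        unfolding f_def by (rule gdist_quadrangle)
      also have "\<dots> \<le> f n + (ennreal (e / 2) + ennreal (e / 2))"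
        using N[of m n] M[of m n] that by (intro add_mono) auto
      also have "ennreal (e / 2) + ennreal (e / 2) = ennreal e"
        using \<open>0 < e\<close> by (simp flip: ennreal_plus)
      finally show ?thesis .
    qed
    have "limsup f \<le> f n + ennreal e" if "n \<ge> max N M" for n
      using * that by (intro Limsup_bounded eventually_sequentiallyI[of "max N M"]) auto
    then have "limsup f - ennreal e \<le> f n" if "n \<ge> max N M" for n
      using that by (simp add: ennreal_minus_le_iff add.commute)
    then have "limsup f - ennreal e \<le> liminf f"
      by (intro Liminf_bounded eventually_sequentiallyI[of "max N M"]) auto
    then show "limsup f \<le> liminf f + ennreal e"
      by (simp add: ennreal_minus_le_iff add.commute)
  qed
  then have "f \<longlonglongrightarrow> liminf f"
    by (intro Liminf_eq_Limsup antisym Liminf_le_Limsup) auto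
  then show ?thesis unfolding f_def by blast
qed

text \<open>This justifies the definite description in \<open>completion_dist\<close>: the limit
  exists and does not depend on the representatives.\<close>

lemma gdist_tendsto_completion_dist:
  assumes "P \<in> completion G" "Q \<in> completion G" "x \<in> P" "y \<in> Q"
  shows "(\<lambda>n. gdist G (x n) (y n)) \<longlonglongrightarrow> completion_dist G P Q"
proof -
  obtain L where L: "(\<lambda>n. gdist G (x n) (y n)) \<longlonglongrightarrow> L"
    using gdist_convergent completion_seqs[OF assms(1,3)] completion_seqs[OF assms(2,4)] by blast
  have all: "(\<lambda>n. gdist G (x' n) (y' n)) \<longlonglongrightarrow> L" if x'y': "x' \<in> P" "y' \<in> Q" for x' y'
  proof -
    obtain M where M: "(\<lambda>n. gdist G (x' n) (y' n)) \<longlonglongrightarrow> M"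
      using gdist_convergent completion_seqs[OF assms(1) x'y'(1)] completion_seqs[OF assms(2) x'y'(2)] by blast
    \<comment> \<open>Representatives of one point have mutual distance tending to zero, so the
      displacement terms of the quadrangle inequality vanish. Exchanging the roles of the two pairs
      gives equality.\<close>
    have le: "L1 \<le> L2" if "(\<lambda>n. gdist G (a n) (b n)) \<longlonglongrightarrow> L1" "(\<lambda>n. gdist G (c n) (d n)) \<longlonglongrightarrow> L2"
      "a \<in> P" "c \<in> P" "b \<in> Q" "d \<in> Q" for a b c d L1 L2
    proof -
      have "(\<lambda>n. gdist G (c n) (d n) + (gdist G (a n) (c n) + gdist G (b n) (d n))) \<longlonglongrightarrow> L2 + (0 + 0)"
        using that assms by (intro tendsto_add completion_seqs_close[OF assms(1)] completion_seqs_close[OF assms(2)])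
      then show ?thesis
        using LIMSEQ_le[OF that(1)] gdist_quadrangle by fastforce
    qed
    have "L = M" using le[OF L M] le[OF M L] x'y' assms by (simp add: antisym)
    then show ?thesis using M by simp
  qed
  have "completion_dist G P Q = L"
    unfolding completion_dist_def
    by (rule the_equality) (use all assms L LIMSEQ_unique in blast)+
  then show ?thesis using L by simp
qed

lemma gdist_tendsto_vertex_dist:
  assumes "a \<in> verts G" "P \<in> completion G" "x \<in> P"
  shows "(\<lambda>n. gdist G a (x n)) \<longlonglongrightarrow> completion_dist G (vertex_point G a) P"
  using gdist_tendsto_completion_dist[OF vertex_point_in_completion[OF assms(1)] assms(2)
      vertex_point_self[OF assms(1)] assms(3)] .

end

section \<open>Components after deleting edges\<close>

text \<open>On vertices, the reflexive transitive closure of this relation means lying in the same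
  component of \<open>G\<close> after deletion of \<open>W\<close>.\<close>

definition adj_avoiding :: "'v wgraph \<Rightarrow> 'v set set \<Rightarrow> ('v \<times> 'v) set" where
  "adj_avoiding G W = {(a, b). {a, b} \<in> edges G - W}"

definition avoiding_ray ::
    "'v wgraph \<Rightarrow> 'v set set \<Rightarrow> (nat \<Rightarrow> 'v) \<Rightarrow> (nat \<Rightarrow> 'v) set \<Rightarrow> bool" where
  "avoiding_ray G W p P \<longleftrightarrow>
     (\<forall>k. (p k, p (Suc k)) \<in> adj_avoiding G W) \<and> vertices_converge G p P sequentially"

lemma adj_avoiding_rtrancl_sym:
  "(a, b) \<in> (adj_avoiding G W)\<^sup>* \<Longrightarrow> (b, a) \<in> (adj_avoiding G W)\<^sup>*"
  by (rule symD[OF sym_rtrancl]) (auto simp: sym_def adj_avoiding_def insert_commute)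

lemma walk_adj_avoiding:
  "xs \<noteq> [] \<Longrightarrow> set (walk_edges xs) \<subseteq> edges G - W \<Longrightarrow> (hd xs, last xs) \<in> (adj_avoiding G W)\<^sup>*"
proof (induction xs rule: walk_edges.induct)
  case (3 x y zs)
  then have "(x, y) \<in> adj_avoiding G W" "(y, last (y # zs)) \<in> (adj_avoiding G W)\<^sup>*"
    by (auto simp: adj_avoiding_def)
  then show ?case by (simp add: converse_rtrancl_into_rtrancl)
qed auto

lemma avoiding_ray_Cons:
  assumes "(a, p 0) \<in> adj_avoiding G W" "avoiding_ray G W p P"
  shows "avoiding_ray G W (case_nat a p) P"
proof -
  have "(\<lambda>k. completion_dist G (vertex_point G (case_nat a p (Suc k))) P) \<longlonglongrightarrow> 0"
    using assms(2) by (simp add: avoiding_ray_def vertices_converge_def)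
  then have "vertices_converge G (case_nat a p) P sequentially"
    unfolding vertices_converge_def by (rule LIMSEQ_imp_Suc)
  then show ?thesis
    using assms by (auto simp: avoiding_ray_def split: nat.split)
qed

text \<open>Finitely many new initial vertices do not affect the limit. A ray can thus be made to
  start at any vertex of its component, in particular where another ray starts.\<close>

lemma avoiding_ray_prepend:
  assumes "(a, b) \<in> (adj_avoiding G W)\<^sup>*" "avoiding_ray G W p P" "p 0 = b"
  shows "\<exists>q. avoiding_ray G W q P \<and> q 0 = a"
  using assms(1)
proof (induction rule: converse_rtrancl_induct)
  case base
  then show ?case using assms by blast
next
  case (step a c)
  then obtain q where q: "avoiding_ray G W q P" "q 0 = c" by blast
  have "avoiding_ray G W (case_nat a q) P"
    using avoiding_ray_Cons[of a q G W P] q step by simp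
  then show ?case by (intro exI[of _ "case_nat a q"]) simp
qed

context edge_weighted_graph
begin

text \<open>All lengths are positive, so a single edge from \<open>W\<close> would already bring the
  sum up to \<delta>.\<close>

lemma short_path_avoiding:
  assumes W: "\<And>f. f \<in> W \<Longrightarrow> \<delta> \<le> len G f" and xs: "finite_path G xs"
    and short: "(\<Sum>e\<leftarrow>walk_edges xs. len G e) < \<delta>"
  shows "set (walk_edges xs) \<subseteq> edges G - W"
proof
  fix f assume f: "f \<in> set (walk_edges xs)"
  have sub: "set (walk_edges xs) \<subseteq> edges G" using xs by (simp add: finite_path_def)
  have "len G f \<le> (\<Sum>e\<leftarrow>walk_edges xs. len G e)"
    using f sub by (intro member_le_sum_list) (auto dest!: len_pos simp: subset_iff intro: less_imp_le)
  then show "f \<in> edges G - W" using W[of f] short sub f by auto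
qed

text \<open>Some path realizes the strict bound and is too short to use \<open>W\<close>. This is
  the link from distances to components.\<close>

lemma close_imp_connected:
  assumes W: "\<And>f. f \<in> W \<Longrightarrow> \<delta> \<le> len G f" and ab: "gdist G a b < ennreal \<delta>"
  shows "(a, b) \<in> (adj_avoiding G W)\<^sup>*"
proof -
  obtain xs where xs: "finite_path G xs" "hd xs = a" "last xs = b"
    "ennreal (\<Sum>e\<leftarrow>walk_edges xs. len G e) < ennreal \<delta>"
    using gdist_lessE[OF ab] by blast
  then have "(\<Sum>e\<leftarrow>walk_edges xs. len G e) < \<delta>"
    by (meson ennreal_leI not_less)
  from short_path_avoiding[OF W xs(1) this] xs(1) have "(hd xs, last xs) \<in> (adj_avoiding G W)\<^sup>*"
    by (intro walk_adj_avoiding) (auto simp: finite_path_def)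
  then show ?thesis using xs by simp
qed

text \<open>Covers a point with an eventually constant representative, which cannot be thinned out
  to a sequence with distinct consecutive terms.\<close>

lemma vertex_point_eqI:
  assumes P: "P \<in> completion G" "x \<in> P" and a: "\<And>n. n \<ge> N \<Longrightarrow> x n = a"
  shows "vertex_point G a = P"
proof -
  have x: "x \<in> cauchy_seqs G" using P completion_seqs by blast
  then have av: "a \<in> verts G" using a[of N] cauchy_seqs_verts by fastforce
  have "\<forall>\<^sub>F n in sequentially. gdist G a (x n) = 0"
    by (rule eventually_sequentiallyI[of N]) (simp add: a gdist_self av)
  then have "((\<lambda>_. a), x) \<in> cauchy_rel G"
    using x av by (auto simp: cauchy_rel_def cauchy_seqs_const intro: tendsto_eventually)
  then have "vertex_point G a = cauchy_rel G `` {x}"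
    unfolding vertex_point_def by (rule equiv_class_eq[OF equiv_cauchy_rel])
  also have "\<dots> = P"
    using P equiv_cauchy_rel unfolding completion_def
    by (metis Image_singleton_iff quotientE equiv_class_eq)
  finally show ?thesis .
qed

text \<open>A Cauchy sequence that is not eventually constant is thinned out so that consecutive terms
  are distinct and joined by short paths; these are concatenated to a ray.\<close>

lemma completion_point_reachable:
  assumes W: "\<And>f. f \<in> W \<Longrightarrow> \<delta> \<le> len G f" and \<delta>: "0 < \<delta>"
    and P: "P \<in> completion G" "x \<in> P"
  obtains r N where "r \<in> verts G" "\<And>n. n \<ge> N \<Longrightarrow> (x n, r) \<in> (adj_avoiding G W)\<^sup>*"
    "vertex_point G r = P \<or> (\<exists>p. avoiding_ray G W p P \<and> p 0 = r)"
proof (cases "\<exists>N. \<forall>n\<ge>N. x n = x N")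
  case True
  then obtain N where N: "\<And>n. n \<ge> N \<Longrightarrow> x n = x N" by blast
  have "x N \<in> verts G" using P completion_seqs cauchy_seqs_verts by blast
  moreover have "vertex_point G (x N) = P" using vertex_point_eqI[OF P N] .
  moreover have "(x n, x N) \<in> (adj_avoiding G W)\<^sup>*" if "n \<ge> N" for n
    using N[OF that] by simp
  ultimately show ?thesis using that by blast
next
  case False
  have x: "x \<in> cauchy_seqs G" using P completion_seqs by blast
  \<comment> \<open>The bound by \<delta> keeps the joining paths away from \<open>W\<close>; the
    bound by \<open>inverse (real (Suc n))\<close> makes the resulting ray converge.\<close>
  define \<epsilon> where "\<epsilon> = (\<lambda>n::nat. min \<delta> (inverse (real (Suc n))))"
  have \<epsilon>: "0 < \<epsilon> n" "\<epsilon> n \<le> \<delta>" for n using \<delta> by (auto simp: \<epsilon>_def)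
  have tail: "\<exists>N. \<forall>i\<ge>N. \<forall>j\<ge>N. gdist G (x i) (x j) < ennreal (\<epsilon> n)" for n
    using x \<epsilon>(1)[of n] by (simp add: cauchy_seqs_def)
  \<comment> \<open>Distinct consecutive terms ensure that every joining path has an edge, as
    \<open>concat_walks\<close> requires.\<close>
  have "\<exists>s. \<forall>n. (\<forall>i\<ge>s n. \<forall>j\<ge>s n. gdist G (x i) (x j) < ennreal (\<epsilon> n)) \<and>
      (s n < s (Suc n) \<and> x (s n) \<noteq> x (s (Suc n)))"
  proof (rule dependent_nat_choice)
    show "\<exists>s. \<forall>i\<ge>s. \<forall>j\<ge>s. gdist G (x i) (x j) < ennreal (\<epsilon> 0)" using tail .
    fix s n
    obtain N where N: "\<forall>i\<ge>N. \<forall>j\<ge>N. gdist G (x i) (x j) < ennreal (\<epsilon> (Suc n))"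
      using tail by blast
    have "\<exists>s'\<ge>max N (Suc s). x s' \<noteq> x s"
      using False by (metis order_refl)
    then obtain s' where "s' \<ge> N" "s < s'" "x s' \<noteq> x s" by auto
    then show "\<exists>s'. (\<forall>i\<ge>s'. \<forall>j\<ge>s'. gdist G (x i) (x j) < ennreal (\<epsilon> (Suc n))) \<and>
        (s < s' \<and> x s \<noteq> x s')"
      using N by (intro exI[of _ s']) (auto dest: order_trans)
  qed
  then obtain s where s_tail: "\<And>n i j. i \<ge> s n \<Longrightarrow> j \<ge> s n \<Longrightarrow> gdist G (x i) (x j) < ennreal (\<epsilon> n)"
    and s_less: "\<And>n. s n < s (Suc n)" and s_neq: "\<And>n. x (s n) \<noteq> x (s (Suc n))"
    by blast
  have "\<exists>xs. finite_path G xs \<and> hd xs = x (s n) \<and> last xs = x (s (Suc n)) \<and>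
      ennreal (\<Sum>e\<leftarrow>walk_edges xs. len G e) < ennreal (\<epsilon> n)" for n
    using gdist_lessE[OF s_tail[of n "s n" "s (Suc n)"]] s_less[of n] by (metis less_imp_le order_refl)
  then obtain L where L: "\<And>n. finite_path G (L n)" "\<And>n. hd (L n) = x (s n)"
    "\<And>n. last (L n) = x (s (Suc n))"
    "\<And>n. ennreal (\<Sum>e\<leftarrow>walk_edges (L n). len G e) < ennreal (\<epsilon> n)"
    by metis
  have "2 \<le> length (L n)" for n
  proof -
    have "L n \<noteq> []" "hd (L n) \<noteq> last (L n)"
      using L(1)[of n] s_neq[of n] by (auto simp: finite_path_def L)
    then show ?thesis by (cases "L n"; cases "tl (L n)") auto
  qed
  then obtain p i where p: "p 0 = hd (L 0)" "\<And>k. {p k, p (Suc k)} \<in> set (walk_edges (L (i k)))"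
    "\<And>k. p k \<in> set (L (i k))" and i: "filterlim i at_top sequentially"
    using concat_walks[of L] L(2,3) by metis
  have avoid: "(p k, p (Suc k)) \<in> adj_avoiding G W" for k
  proof -
    have "(\<Sum>e\<leftarrow>walk_edges (L (i k)). len G e) < \<epsilon> (i k)"
      using L(4)[of "i k"] by (meson ennreal_leI not_less)
    also have "\<dots> \<le> \<delta>" using \<epsilon> by blast
    finally show ?thesis
      using short_path_avoiding[OF W L(1)] p(2)[of k] by (auto simp: adj_avoiding_def)
  qed
  have pv: "p k \<in> verts G" for k using p(3)[of k] L(1)[of "i k"] by (auto simp: finite_path_def)
  \<comment> \<open>One \<epsilon> leads from \<open>p k\<close> back to the head of its path,
    another from there to the later terms of \<open>x\<close>.\<close>
  have near: "completion_dist G (vertex_point G (p k)) P \<le> ennreal (2 * \<epsilon> (i k))" for k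
  proof (rule LIMSEQ_le_const2[OF gdist_tendsto_vertex_dist[OF pv P]])
    have "gdist G (p k) (x n) \<le> ennreal (2 * \<epsilon> (i k))" if "n \<ge> s (i k)" for n
    proof -
      have "gdist G (p k) (x n) \<le> gdist G (p k) (x (s (i k))) + gdist G (x (s (i k))) (x n)"
        by (rule gdist_triangle)
      also have "gdist G (p k) (x (s (i k))) \<le> ennreal (\<epsilon> (i k))"
        using gdist_hd_le[OF L(1) p(3)[of k]] L(4)[of "i k"] unfolding L(2) gdist_sym[of "p k"] by simp
      also have "gdist G (x (s (i k))) (x n) \<le> ennreal (\<epsilon> (i k))"
        using s_tail that by (simp add: less_imp_le)
      also have "ennreal (\<epsilon> (i k)) + ennreal (\<epsilon> (i k)) = ennreal (2 * \<epsilon> (i k))"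
        using \<epsilon>(1)[of "i k"] by (simp flip: ennreal_plus)
      finally show ?thesis by (simp add: add_mono)
    qed
    then show "\<exists>N. \<forall>n\<ge>N. gdist G (p k) (x n) \<le> ennreal (2 * \<epsilon> (i k))" by blast
  qed
  have "\<epsilon> \<longlonglongrightarrow> min \<delta> 0"
    unfolding \<epsilon>_def by (intro tendsto_min tendsto_const LIMSEQ_inverse_real_of_nat)
  then have "(\<lambda>n. ennreal (2 * \<epsilon> n)) \<longlonglongrightarrow> ennreal (2 * 0)"
    using \<delta> by (intro tendsto_ennrealI tendsto_mult_left) simp
  then have "(\<lambda>k. ennreal (2 * \<epsilon> (i k))) \<longlonglongrightarrow> 0"
    using filterlim_compose[OF _ i] by simp
  then have "vertices_converge G p P sequentially"
    unfolding vertices_converge_def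
    by (rule ennreal_tendsto_0_le) (rule near)
  then have "avoiding_ray G W p P" using avoid by (simp add: avoiding_ray_def)
  moreover have "(x n, x (s 0)) \<in> (adj_avoiding G W)\<^sup>*" if "n \<ge> s 0" for n
    by (rule close_imp_connected[OF W])
      (use s_tail[of 0 n "s 0"] that \<epsilon>(2)[of 0] in \<open>auto intro: less_le_trans ennreal_leI\<close>)
  moreover have "x (s 0) \<in> verts G" using x cauchy_seqs_verts by blast
  moreover have "p 0 = x (s 0)" by (simp add: p L)
  ultimately show ?thesis using that by blast
qed

section \<open>Finite paths, rays and double rays avoiding the deleted edges\<close>

lemma connected_imp_avoiding_path:
  assumes "(a, b) \<in> (adj_avoiding G W)\<^sup>*" "b \<in> verts G"
  shows "\<exists>xs. finite_path G xs \<and> hd xs = a \<and> last xs = b \<and> set (walk_edges xs) \<inter> W = {}"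
  using assms(1)
proof (induction rule: converse_rtrancl_induct)
  case base
  then show ?case using assms(2) by (intro exI[of _ "[b]"]) (simp add: finite_path_def)
next
  case (step a c)
  then obtain xs where xs: "finite_path G xs" "hd xs = c" "last xs = b"
    "set (walk_edges xs) \<inter> W = {}" by blast
  have ac: "{a, c} \<in> edges G - W" using step by (simp add: adj_avoiding_def)
  obtain zs where zs: "xs = c # zs" using xs by (cases xs) (auto simp: finite_path_def)
  show ?case
    by (rule exI[of _ "a # xs"]) (use xs zs ac edge_verts[of a c] in \<open>auto simp: finite_path_def\<close>)
qed

lemma avoiding_ray_is_gpath:
  assumes "avoiding_ray G W p P"
  shows "is_gpath G (Ray p)" "gpath_edges (Ray p) \<inter> W = {}"
  using assms edge_verts by (auto simp: avoiding_ray_def adj_avoiding_def)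

lemma avoiding_double_ray:
  assumes "avoiding_ray G W p P" "avoiding_ray G W q Q" "p 0 = q 0"
  shows "\<exists>\<gamma>. is_gpath G \<gamma> \<and> goes_from_to G \<gamma> P Q \<and> gpath_edges \<gamma> \<inter> W = {}"
proof -
  \<comment> \<open>\<open>p\<close> is traversed backwards on the negative integers and
    \<open>q\<close> forwards from \<open>0\<close>; the common start \<open>p 0 = q 0\<close>
    closes the step from \<open>- 1\<close> to \<open>0\<close>.\<close>
  define d where "d = (\<lambda>k::int. if k \<ge> 0 then q (nat k) else p (nat (- k)))"
  have adj: "{d k, d (k + 1)} \<in> edges G - W" for k
  proof (cases "k \<ge> 0")
    case True
    then have "d k = q (nat k)" "d (k + 1) = q (Suc (nat k))" by (auto simp: d_def nat_add_distrib)
    then show ?thesis using assms by (simp add: avoiding_ray_def adj_avoiding_def)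
  next
    case False
    define m where "m = nat (- (k + 1))"
    have "d k = p (Suc m)" using False by (simp add: d_def m_def Suc_nat_eq_nat_zadd1)
    moreover have "d (k + 1) = p m"
      using False assms(3) by (cases "k = - 1") (auto simp: d_def m_def)
    ultimately show ?thesis
      using assms by (simp add: avoiding_ray_def adj_avoiding_def insert_commute)
  qed
  have "filterlim nat sequentially at_top"
    unfolding filterlim_at_top eventually_at_top_linorder by (metis nat_int nat_mono)
  moreover have "filterlim (\<lambda>k. nat (- k)) sequentially at_bot"
    unfolding filterlim_at_top eventually_at_bot_linorder
  proof
    fix Z show "\<exists>N. \<forall>n\<le>N. Z \<le> nat (- n)" by (rule exI[of _ "- int Z"]) auto
  qed
  ultimately have
    lim: "((\<lambda>k. completion_dist G (vertex_point G (q (nat k))) Q) \<longlongrightarrow> 0) at_top"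
      "((\<lambda>k. completion_dist G (vertex_point G (p (nat (- k)))) P) \<longlongrightarrow> 0) at_bot"
    using assms by (auto simp: avoiding_ray_def vertices_converge_def intro: filterlim_compose)
  have "vertices_converge G d Q at_top"
    unfolding vertices_converge_def
    by (rule Lim_transform_eventually[OF lim(1)])
      (use eventually_ge_at_top[of "0::int"] in \<open>eventually_elim, simp add: d_def\<close>)
  moreover have "vertices_converge G d P at_bot"
    unfolding vertices_converge_def
    by (rule Lim_transform_eventually[OF lim(2)])
      (use eventually_le_at_bot[of "- 1::int"] in \<open>eventually_elim, simp add: d_def\<close>)
  ultimately show ?thesis
    using adj edge_verts by (intro exI[of _ "Double_Ray d"]) auto
qed

text \<open>The conclusion speaks only of edges and distances, no longer of paths between points of
  the completion, so it can be carried over to a comparable metric.\<close>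

lemma weakly_connected_components:
  assumes wc: "weakly_connected G" and P: "P \<in> completion G" and Q: "Q \<in> completion G"
    and neq: "P \<noteq> Q" and xy: "x \<in> P" "y \<in> Q"
  obtains W \<delta> A N where "finite W" "0 < \<delta>" "A \<subseteq> verts G"
    "\<And>a b. {a, b} \<in> edges G \<Longrightarrow> a \<in> A \<Longrightarrow> b \<notin> A \<Longrightarrow> {a, b} \<in> W"
    "\<And>a b. a \<in> A \<Longrightarrow> b \<in> verts G - A \<Longrightarrow> ennreal \<delta> \<le> gdist G a b"
    "\<And>n. n \<ge> N \<Longrightarrow> x n \<in> A" "\<And>n. n \<ge> N \<Longrightarrow> y n \<notin> A"
proof -
  have "\<exists>W. finite W \<and> W \<subseteq> edges G \<and>
      (\<forall>\<gamma>. is_gpath G \<gamma> \<and> goes_from_to G \<gamma> P Q \<longrightarrow> gpath_edges \<gamma> \<inter> W \<noteq> {})"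
    using wc P Q neq by (simp add: weakly_connected_def)
  then obtain W where W: "finite W" "W \<subseteq> edges G"
    and sep: "\<And>\<gamma>. is_gpath G \<gamma> \<Longrightarrow> goes_from_to G \<gamma> P Q \<Longrightarrow> gpath_edges \<gamma> \<inter> W \<noteq> {}"
    by blast
  \<comment> \<open>The extra element \<open>1\<close> supplies a positive value when
    \<open>W\<close> is empty.\<close>
  define \<delta> where "\<delta> = Min (insert 1 (len G ` W))"
  have \<delta>: "0 < \<delta>" using W len_pos by (auto simp: \<delta>_def)
  have le: "\<delta> \<le> len G f" if "f \<in> W" for f using W that by (auto simp: \<delta>_def)
  let ?E = "adj_avoiding G W"
  obtain r N where r: "r \<in> verts G" "\<And>n. n \<ge> N \<Longrightarrow> (x n, r) \<in> ?E\<^sup>*"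
    "vertex_point G r = P \<or> (\<exists>p. avoiding_ray G W p P \<and> p 0 = r)"
    using completion_point_reachable[OF le \<delta> P xy(1)] by blast
  obtain t M where t: "t \<in> verts G" "\<And>n. n \<ge> M \<Longrightarrow> (y n, t) \<in> ?E\<^sup>*"
    "vertex_point G t = Q \<or> (\<exists>p. avoiding_ray G W p Q \<and> p 0 = t)"
    using completion_point_reachable[OF le \<delta> Q xy(2)] by blast
  \<comment> \<open>Each of \<open>P\<close> and \<open>Q\<close> is either a vertex or the limit of
    a ray. The four combinations yield a finite path, a ray in either direction, or a double
    ray.\<close>
  have separated: "(r, t) \<notin> ?E\<^sup>*"
  proof
    assume rt: "(r, t) \<in> ?E\<^sup>*"
    note tr = adj_avoiding_rtrancl_sym[OF rt]
    show False
    proof (cases "vertex_point G r = P")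
      case vP: True
      show False
      proof (cases "vertex_point G t = Q")
        case True
        obtain xs where "finite_path G xs" "hd xs = r" "last xs = t" "set (walk_edges xs) \<inter> W = {}"
          using connected_imp_avoiding_path[OF rt t(1)] by blast
        then show False using sep[of "Finite_Path xs"] vP True by simp
      next
        case False
        then obtain q where q: "avoiding_ray G W q Q" "q 0 = r"
          using t(3) avoiding_ray_prepend[OF rt] by blast
        then have "goes_from_to G (Ray q) P Q" using vP by (simp add: avoiding_ray_def)
        then show False using sep avoiding_ray_is_gpath[OF q(1)] by blast
      qed
    next
      case False
      then obtain p where p: "avoiding_ray G W p P" "p 0 = t"
        using r(3) avoiding_ray_prepend[OF tr] by blast
      show False
      proof (cases "vertex_point G t = Q")
        case True
        then have "goes_from_to G (Ray p) P Q" using p by (simp add: avoiding_ray_def)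
        then show False using sep avoiding_ray_is_gpath[OF p(1)] by blast
      next
        case False
        then show False using t(3) p avoiding_double_ray[OF p(1)] sep by metis
      qed
    qed
  qed
  define A where "A = {a \<in> verts G. (a, r) \<in> ?E\<^sup>*}"
  show ?thesis
  proof (rule that[of W \<delta> A "max N M"])
    fix a b assume ab: "{a, b} \<in> edges G" "a \<in> A" "b \<notin> A"
    show "{a, b} \<in> W"
    proof (rule ccontr)
      assume "{a, b} \<notin> W"
      then have "(b, a) \<in> ?E" using ab by (simp add: adj_avoiding_def insert_commute)
      then show False using ab edge_verts[OF ab(1)]
        by (auto simp: A_def dest: converse_rtrancl_into_rtrancl)
    qed
  next
    fix a b assume ab: "a \<in> A" "b \<in> verts G - A"
    show "ennreal \<delta> \<le> gdist G a b"
    proof (rule ccontr)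
      assume "\<not> ?thesis"
      then have "(b, a) \<in> ?E\<^sup>*" by (intro close_imp_connected[OF le]) (auto simp: gdist_sym)
      then show False using ab by (auto simp: A_def dest: rtrancl_trans)
    qed
  next
    fix n assume "max N M \<le> n"
    then show "x n \<in> A"
      using r(2) P xy completion_seqs cauchy_seqs_verts by (auto simp: A_def)
  next
    fix n assume n: "max N M \<le> n"
    show "y n \<notin> A"
    proof
      assume "y n \<in> A"
      then have "(r, y n) \<in> ?E\<^sup>*" by (auto simp: A_def intro: adj_avoiding_rtrancl_sym)
      then show False using separated t(2)[of n] n by (auto dest: rtrancl_trans)
    qed
  qed (use W \<delta> in \<open>auto simp: A_def\<close>)
qed

section \<open>Edges leaving a separated vertex set\<close>

text \<open>Vertices closer than \<eta> cannot lie on different sides of \<open>A\<close>, and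
  \<open>p k\<close> eventually comes that close to late terms of \<open>x\<close>. The Boolean
  \<open>B\<close> lets one statement treat both sides.\<close>

lemma vertices_converge_same_side:
  assumes sep: "\<And>a b. a \<in> A \<Longrightarrow> b \<in> verts G - A \<Longrightarrow> ennreal \<eta> \<le> gdist G a b" and \<eta>: "0 < \<eta>"
    and P: "P \<in> completion G" "x \<in> P" and side: "\<And>n. n \<ge> N \<Longrightarrow> (x n \<in> A) = B"
    and p: "\<And>k. p k \<in> verts G" and conv: "vertices_converge G p P F"
  shows "\<forall>\<^sub>F k in F. (p k \<in> A) = B"
proof -
  have "\<forall>\<^sub>F k in F. completion_dist G (vertex_point G (p k)) P < ennreal \<eta>"
    using conv \<eta> unfolding vertices_converge_def by (intro order_tendstoD(2)[of _ 0]) auto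
  then show ?thesis
  proof eventually_elim
    case (elim k)
    have "\<forall>\<^sub>F n in sequentially. gdist G (p k) (x n) < ennreal \<eta>"
      using order_tendstoD(2)[OF gdist_tendsto_vertex_dist[OF p P] elim] .
    moreover have "\<forall>\<^sub>F n in sequentially. n \<ge> N" by (rule eventually_ge_at_top)
    ultimately have "\<forall>\<^sub>F n in sequentially. gdist G (p k) (x n) < ennreal \<eta> \<and> n \<ge> N"
      by (rule eventually_conj)
    then obtain n where n: "gdist G (p k) (x n) < ennreal \<eta>" "n \<ge> N"
      using eventually_happens trivial_limit_sequentially by blast
    have "x n \<in> verts G" using P completion_seqs cauchy_seqs_verts by blast
    then have "(p k \<in> A) = (x n \<in> A)"
      using n(1) sep[of "p k" "x n"] sep[of "x n" "p k"] p[of k]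
      by (auto simp: gdist_sym[of "x n"] not_le[symmetric])
    then show ?case using side n by blast
  qed
qed

text \<open>The constant sequence at \<open>a\<close> converges to \<open>P\<close>, so this is an
  instance of the convergent case.\<close>

lemma vertex_point_same_side:
  assumes sep: "\<And>a b. a \<in> A \<Longrightarrow> b \<in> verts G - A \<Longrightarrow> ennreal \<eta> \<le> gdist G a b" and \<eta>: "0 < \<eta>"
    and P: "P \<in> completion G" "x \<in> P" and side: "\<And>n. n \<ge> N \<Longrightarrow> (x n \<in> A) = B"
    and a: "a \<in> verts G" "vertex_point G a = P"
  shows "(a \<in> A) = B"
proof -
  have "completion_dist G P P = 0"
    using LIMSEQ_unique[OF gdist_tendsto_completion_dist completion_seqs_close] P by blast
  then have "vertices_converge G (\<lambda>_::nat. a) P sequentially"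
    using a by (simp add: vertices_converge_def)
  from vertices_converge_same_side[OF sep \<eta> P side _ this] a show ?thesis by simp
qed

text \<open>Each end of a path, whether a vertex or a limit, forces some vertex of the path onto its
  own side of \<open>A\<close>; the side therefore changes along an edge.\<close>

lemma gpath_crosses:
  assumes sep: "\<And>a b. a \<in> A \<Longrightarrow> b \<in> verts G - A \<Longrightarrow> ennreal \<eta> \<le> gdist G a b" and \<eta>: "0 < \<eta>"
    and P: "P \<in> completion G" "x \<in> P" and Q: "Q \<in> completion G" "y \<in> Q"
    and side: "\<And>n. n \<ge> N \<Longrightarrow> x n \<in> A" "\<And>n. n \<ge> N \<Longrightarrow> y n \<notin> A"
    and \<gamma>: "is_gpath G \<gamma>" "goes_from_to G \<gamma> P Q"
  shows "\<exists>a b. {a, b} \<in> gpath_edges \<gamma> \<and> a \<in> A \<and> b \<notin> A"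
proof -
  have sides: "\<And>n. n \<ge> N \<Longrightarrow> (x n \<in> A) = True" "\<And>n. n \<ge> N \<Longrightarrow> (y n \<in> A) = False"
    using side by auto
  \<comment> \<open>An arbitrary nontrivial filter covers rays and both ends of double rays at
    once.\<close>
  have P_conv: "\<exists>k. p k \<in> A"
    if "F \<noteq> bot" "vertices_converge G p P F" "\<And>k. p k \<in> verts G" for p :: "'i \<Rightarrow> 'v" and F
    using eventually_happens'[OF that(1) vertices_converge_same_side[OF sep \<eta> P sides(1) that(3,2)]] by simp
  have Q_conv: "\<exists>k. p k \<notin> A"
    if "F \<noteq> bot" "vertices_converge G p Q F" "\<And>k. p k \<in> verts G" for p :: "'i \<Rightarrow> 'v" and F
    using eventually_happens'[OF that(1) vertices_converge_same_side[OF sep \<eta> Q sides(2) that(3,2)]] by simp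
  have P_vertex: "a \<in> A" if "a \<in> verts G" "vertex_point G a = P" for a
    using vertex_point_same_side[OF sep \<eta> P sides(1) that] by simp
  have Q_vertex: "a \<notin> A" if "a \<in> verts G" "vertex_point G a = Q" for a
    using vertex_point_same_side[OF sep \<eta> Q sides(2) that] by simp
  show ?thesis
  proof (cases \<gamma>)
    case (Finite_Path xs)
    then have "xs \<noteq> []" "hd xs \<in> verts G" "last xs \<in> verts G"
      using \<gamma>(1) by (auto simp: finite_path_def)
    then have "hd xs \<in> A" "last xs \<notin> A" using \<gamma>(2) Finite_Path P_vertex Q_vertex by auto
    then show ?thesis using walk_edges_crossing \<open>xs \<noteq> []\<close> Finite_Path by auto
  next
    case (Ray p)
    have v: "p k \<in> verts G" for k using \<gamma>(1) Ray by auto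
    have "\<exists>i j. (p i \<in> A) \<noteq> (p j \<in> A)"
      using \<gamma>(2) unfolding Ray goes_from_to.simps
    proof (elim disjE conjE)
      assume "vertex_point G (p 0) = P" "vertices_converge G p Q sequentially"
      then have "p 0 \<in> A" "\<exists>j. p j \<notin> A"
        using P_vertex[OF v] Q_conv[of sequentially p] v by auto
      then show ?thesis by blast
    next
      assume "vertices_converge G p P sequentially" "vertex_point G (p 0) = Q"
      then have "p 0 \<notin> A" "\<exists>j. p j \<in> A"
        using Q_vertex[OF v] P_conv[of sequentially p] v by auto
      then show ?thesis by blast
    qed
    then obtain k where "(p k \<in> A) \<noteq> (p (k + 1) \<in> A)" using nat_sequence_crossing by blast
    then show ?thesis unfolding Ray gpath_edges.simps by (smt (verit) insert_commute mem_Collect_eq)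
  next
    case (Double_Ray p)
    have v: "p k \<in> verts G" for k using \<gamma>(1) Double_Ray by auto
    have "\<exists>i. p i \<in> A" "\<exists>j. p j \<notin> A"
      using \<gamma>(2) P_conv[of at_bot p] Q_conv[of at_top p] v
      unfolding Double_Ray by auto
    then obtain k where "(p k \<in> A) \<noteq> (p (k + 1) \<in> A)" using int_sequence_crossing by blast
    then show ?thesis
      unfolding Double_Ray gpath_edges.simps by (smt (verit) insert_commute mem_Collect_eq)
  qed
qed

end

section \<open>Comparable metrics\<close>

text \<open>Only a one-sided bound is assumed, so that \<open>completion_eq\<close> can apply the
  result in both directions.\<close>

lemma cauchy_seqs_mono:
  assumes "verts H = verts G" "0 < C"
    and le: "\<And>u v. u \<in> verts G \<Longrightarrow> v \<in> verts G \<Longrightarrow> gdist H u v \<le> ennreal C * gdist G u v"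
  shows "cauchy_seqs G \<subseteq> cauchy_seqs H"
proof
  fix x assume x: "x \<in> cauchy_seqs G"
  have "\<exists>N. \<forall>m\<ge>N. \<forall>n\<ge>N. gdist H (x m) (x n) < ennreal \<epsilon>" if "0 < \<epsilon>" for \<epsilon>
  proof -
    have "0 < \<epsilon> / C" using that assms by simp
    then have "\<exists>N. \<forall>m\<ge>N. \<forall>n\<ge>N. gdist G (x m) (x n) < ennreal (\<epsilon> / C)"
      using x by (simp add: cauchy_seqs_def)
    then obtain N where N: "\<And>m n. m \<ge> N \<Longrightarrow> n \<ge> N \<Longrightarrow> gdist G (x m) (x n) < ennreal (\<epsilon> / C)"
      by blast
    have "gdist H (x m) (x n) < ennreal \<epsilon>" if "m \<ge> N" "n \<ge> N" for m n
    proof -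
      have "gdist H (x m) (x n) \<le> ennreal C * gdist G (x m) (x n)"
        using x by (intro le) (auto simp: cauchy_seqs_def)
      also have "\<dots> < ennreal C * ennreal (\<epsilon> / C)"
        using N[OF that] \<open>0 < C\<close> by (intro ennreal_mult_strict_left_mono) auto
      also have "\<dots> = ennreal \<epsilon>"
        using \<open>0 < C\<close> \<open>0 < \<epsilon>\<close> by (simp flip: ennreal_mult)
      finally show ?thesis .
    qed
    then show ?thesis by blast
  qed
  then show "x \<in> cauchy_seqs H" using x assms(1) by (auto simp: cauchy_seqs_def)
qed

lemma cauchy_rel_mono:
  assumes "verts H = verts G" "0 < C"
    and le: "\<And>u v. u \<in> verts G \<Longrightarrow> v \<in> verts G \<Longrightarrow> gdist H u v \<le> ennreal C * gdist G u v"
  shows "cauchy_rel G \<subseteq> cauchy_rel H"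
proof clarify
  fix x y assume xy: "(x, y) \<in> cauchy_rel G"
  then have lim: "(\<lambda>n. ennreal C * gdist G (x n) (y n)) \<longlonglongrightarrow> ennreal C * 0"
    by (intro ennreal_tendsto_cmult) (auto simp: cauchy_rel_def)
  have "x n \<in> verts G" "y n \<in> verts G" for n
    using xy by (auto simp: cauchy_rel_def cauchy_seqs_def)
  then have "gdist H (x n) (y n) \<le> ennreal C * gdist G (x n) (y n)" for n
    by (simp add: le)
  with lim have "(\<lambda>n. gdist H (x n) (y n)) \<longlonglongrightarrow> 0"
    by (auto intro: ennreal_tendsto_0_le[of "\<lambda>n. ennreal C * gdist G (x n) (y n)"])
  then show "(x, y) \<in> cauchy_rel H"
    using xy cauchy_seqs_mono[OF assms] by (auto simp: cauchy_rel_def)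
qed

text \<open>The same sequences are Cauchy and the same pairs are equivalent. The completions are
  thus equal as sets of classes, and no identification map is needed.\<close>

lemma completion_eq:
  assumes "verts H = verts G" "0 < C" "0 < D"
    and "\<And>u v. u \<in> verts G \<Longrightarrow> v \<in> verts G \<Longrightarrow> gdist H u v \<le> ennreal C * gdist G u v"
    and "\<And>u v. u \<in> verts G \<Longrightarrow> v \<in> verts G \<Longrightarrow> gdist G u v \<le> ennreal D * gdist H u v"
  shows "completion H = completion G"
proof -
  have "cauchy_seqs H = cauchy_seqs G"
    using cauchy_seqs_mono[of H G C] cauchy_seqs_mono[of G H D] assms by (intro antisym) auto
  moreover have "cauchy_rel H = cauchy_rel G"
    using cauchy_rel_mono[of H G C] cauchy_rel_mono[of G H D] assms by (intro antisym) auto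
  ultimately show ?thesis by (simp add: completion_def)
qed

text \<open>The index set \<open>I\<close> is all of the naturals or an initial segment, so a finite
  list of added edges is included; the limit condition concerns the infinite case.\<close>

theorem theorem2p3:
  fixes G0 G1 :: "'v wgraph" and E1 :: "'v set set"
    and I :: "nat set" and e :: "nat \<Rightarrow> 'v set" and C :: real
  assumes "edge_weighted_graph G0"
    and "edge_weighted_graph G1"
    and "weakly_connected G0"
    and "verts G1 = verts G0"
    and "edges G1 = edges G0 \<union> E1"
    and "edges G0 \<inter> E1 = {}"
    and "\<And>f. f \<in> edges G0 \<Longrightarrow> len G1 f = len G0 f"
    and "I = UNIV \<or> (\<exists>N. I = {..<N})"
    and "bij_betw e I E1"
    and "I = UNIV \<Longrightarrow> (\<lambda>n. len G1 (e n)) \<longlonglongrightarrow> 0"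
    and "0 < C"
    and "\<And>u v. u \<in> verts G0 \<Longrightarrow> v \<in> verts G0 \<Longrightarrow>
           gdist G1 u v \<le> gdist G0 u v \<and> gdist G0 u v \<le> ennreal C * gdist G1 u v"
  shows "weakly_connected G1"
proof -
  interpret G0: edge_weighted_graph G0 by fact
  interpret G1: edge_weighted_graph G1 by fact
  have comp: "completion G1 = completion G0"
    by (rule completion_eq[of _ _ 1 C]) (use assms(4,11,12) in auto)
  \<comment> \<open>For an infinite sequence this is the convergence of the lengths to zero;
    otherwise \<open>I\<close> itself is finite.\<close>
  have finite_long: "finite {n \<in> I. \<eta> \<le> len G1 (e n)}" if "0 < \<eta>" for \<eta>
  proof (cases "I = UNIV")
    case True
    then have "\<forall>\<^sub>F n in sequentially. len G1 (e n) < \<eta>"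
      using assms(10) that by (intro order_tendstoD) auto
    then obtain N where "\<And>n. n \<ge> N \<Longrightarrow> len G1 (e n) < \<eta>"
      unfolding eventually_sequentially by blast
    then have "{n \<in> I. \<eta> \<le> len G1 (e n)} \<subseteq> {..<N}"
      by (auto simp: not_le[symmetric])
    then show ?thesis by (rule finite_subset) simp
  next
    case False
    then show ?thesis using assms(8) by auto
  qed
  show ?thesis
    unfolding weakly_connected_def
  proof (intro ballI impI)
    fix P Q assume PQ: "P \<in> completion G1" "Q \<in> completion G1" "P \<noteq> Q"
    obtain x y where xy: "x \<in> P" "y \<in> Q" using PQ G1.completion_nonempty by blast
    obtain W \<delta> A N where W: "finite W" and \<delta>: "0 < \<delta>" and A: "A \<subseteq> verts G0"
      and cross: "\<And>a b. {a, b} \<in> edges G0 \<Longrightarrow> a \<in> A \<Longrightarrow> b \<notin> A \<Longrightarrow> {a, b} \<in> W"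
      and sep0: "\<And>a b. a \<in> A \<Longrightarrow> b \<in> verts G0 - A \<Longrightarrow> ennreal \<delta> \<le> gdist G0 a b"
      and side: "\<And>n. n \<ge> N \<Longrightarrow> x n \<in> A" "\<And>n. n \<ge> N \<Longrightarrow> y n \<notin> A"
      using G0.weakly_connected_components[OF assms(3)] PQ xy unfolding comp by metis
    \<comment> \<open>Dividing by \<open>C\<close> turns the gap \<delta> for \<open>G0\<close> into
      a gap for \<open>G1\<close>, since \<open>gdist G0\<close> is at most \<open>C\<close> times
      \<open>gdist G1\<close>.\<close>
    define \<eta> where "\<eta> = \<delta> / C"
    have \<eta>: "0 < \<eta>" using \<delta> assms(11) by (simp add: \<eta>_def)
    have sep: "ennreal \<eta> \<le> gdist G1 a b" if "a \<in> A" "b \<in> verts G1 - A" for a b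
    proof (rule ccontr)
      assume "\<not> ?thesis"
      then have "ennreal C * gdist G1 a b < ennreal C * ennreal \<eta>"
        using assms(11) by (intro ennreal_mult_strict_left_mono) auto
      also have "\<dots> = ennreal \<delta>"
        using assms(11) \<delta> by (simp add: \<eta>_def flip: ennreal_mult)
      also have "\<dots> \<le> gdist G0 a b" using sep0 that assms(4) by auto
      also have "\<dots> \<le> ennreal C * gdist G1 a b" using assms(4,12) that A by auto
      finally show False by simp
    qed
    define W1 where "W1 = {f \<in> edges G1. \<exists>a b. f = {a, b} \<and> a \<in> A \<and> b \<notin> A}"
    \<comment> \<open>An old edge leaving \<open>A\<close> belongs to \<open>W\<close>. An added one
      joins vertices at distance at least \<eta>, and an edge is never shorter than the distance of
      its ends.\<close>
    have "W1 \<subseteq> W \<union> e ` {n \<in> I. \<eta> \<le> len G1 (e n)}"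
    proof
      fix f assume "f \<in> W1"
      then obtain a b where f: "f \<in> edges G1" "f = {a, b}" "a \<in> A" "b \<notin> A"
        by (auto simp: W1_def)
      show "f \<in> W \<union> e ` {n \<in> I. \<eta> \<le> len G1 (e n)}"
      proof (cases "f \<in> edges G0")
        case True
        then show ?thesis using cross f by blast
      next
        case False
        then obtain n where n: "n \<in> I" "f = e n"
          using f(1) assms(5,9) by (auto simp: bij_betw_def)
        have "ennreal \<eta> \<le> gdist G1 a b" using sep f G1.edge_verts by blast
        also have "\<dots> \<le> ennreal (len G1 f)" using G1.gdist_edge_le f by blast
        finally have "\<eta> \<le> len G1 f" using G1.len_pos[OF f(1)] by simp
        then show ?thesis using n by auto
      qed
    qed
    then have "finite W1" by (rule finite_subset) (use W finite_long[OF \<eta>] in auto)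
    moreover have "gpath_edges \<gamma> \<inter> W1 \<noteq> {}" if \<gamma>: "is_gpath G1 \<gamma>" "goes_from_to G1 \<gamma> P Q" for \<gamma>
    proof -
      obtain a b where "{a, b} \<in> gpath_edges \<gamma>" "a \<in> A" "b \<notin> A"
        using G1.gpath_crosses[OF sep \<eta> PQ(1) xy(1) PQ(2) xy(2) side \<gamma>] by blast
      moreover have "gpath_edges \<gamma> \<subseteq> edges G1"
        using \<gamma>(1) by (cases \<gamma>) (auto simp: finite_path_def)
      ultimately show ?thesis by (auto simp: W1_def)
    qed
    ultimately show "\<exists>W. finite W \<and> W \<subseteq> edges G1 \<and>
        (\<forall>\<gamma>. is_gpath G1 \<gamma> \<and> goes_from_to G1 \<gamma> P Q \<longrightarrow> gpath_edges \<gamma> \<inter> W \<noteq> {})"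
      by (intro exI[of _ W1]) (auto simp: W1_def)
  qed
qed

end
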